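(* Let $R$ be a commutative ring with $1\neq 0$, let $\beta\in\{\text{associate},\ \text{strong associate},\ \text{very strong associate}\}$, and let $x\in R$ be a non-unit. Then the following are equivalent. (1) $x$ has a finite number of factorizations up to rearrangement and $\beta$. (2) $\sum_{a\in V(G_\emptyset^\beta(x))}\mathrm{degl}(a)<\infty$. (3) $|E(G_\emptyset^\beta(x))|<\infty$ (loops are counted as edges).
   Context: $U(R)$ is the group of units of $R$. For $a,b\in R$: $a,b$ are associates, $a\sim b$, if $(a)=(b)$; strong associates, $a\approx b$, if $a=\lambda b$ for some $\lambda\in U(R)$; very strong associates, $a\cong b$, if $a\sim b$ and either $a=b=0$ or ($a=rb$ with $r\in R$ implies $r\in U(R)$). A factorization of a non-unit $x$ is an expression $x=a_1\cdots a_n$, $n\ge 1$, with every $a_i\in R$ a non-unit. Two factorizations $a_1\cdots a_n$, $b_1\cdots b_m$ agree up to rearrangement and $\beta$ if $n=m$ and, after reordering, $a_i$ and $b_i$ are equal or $\beta$ for every $i$. The divisor graph $G_\emptyset^\beta(x)$: let $A^\beta(R)$ be a fixed set of representatives of the set $R\setminus U(R)$ of non-units up to $\beta$ (two elements are identified iff they are equal or $\beta$). The vertex set is $V(G_\emptyset^\beta(x))=\{a\in A^\beta(R): a\mid x\}$. Distinct vertices $a,b$ are joined by an edge iff there is a factorization of the form $x=ab\,a_1\cdots a_m$ ($m\ge 0$). A vertex $a$ carries $n-1$ loops, where $n$ is the largest integer such that there is a factorization $x=a^n a_1\cdots a_m$ ($m\ge0$), and infinitely many loops if such $n$ are unbounded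 (no loops if there is no such factorization). In these edge and loop conditions a unit factor is allowed, i.e. $x=\lambda ab\,a_1\cdots a_m$, resp. $x=\lambda a^n a_1\cdots a_m$, with $\lambda\in U(R)$. The edge set $E$ includes loops. $\deg(a)$ is the number of vertices different from $a$ and adjacent to $a$; $\mathrm{degl}(a)$ is $\deg(a)$ plus the number of loops at $a$. *)

theory Defs
  imports "HOL-Analysis.Infinite_Sum" "HOL-Library.Extended_Nat" "HOL-Library.Multiset"
begin

text \<open>The ring R is a type of class \<^class>\<open>comm_ring_1\<close>, so that \<open>1 \<noteq> 0\<close>.\<close>

definition ring_units :: "'a::comm_ring_1 set" where
  "ring_units = {u. u dvd 1}"

definition principal_ideal :: "'a::comm_ring_1 \<Rightarrow> 'a set" where
  "principal_ideal a = {r * a | r. True}"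

definition assoc_rel :: "'a::comm_ring_1 \<Rightarrow> 'a \<Rightarrow> bool" where
  "assoc_rel a b \<longleftrightarrow> principal_ideal a = principal_ideal b"

definition strong_assoc_rel :: "'a::comm_ring_1 \<Rightarrow> 'a \<Rightarrow> bool" where
  "strong_assoc_rel a b \<longleftrightarrow> (\<exists>u. u \<in> ring_units \<and> a = u * b)"

definition very_strong_assoc_rel :: "'a::comm_ring_1 \<Rightarrow> 'a \<Rightarrow> bool" where
  "very_strong_assoc_rel a b \<longleftrightarrow>
     assoc_rel a b \<and> (a = 0 \<and> b = 0 \<or> (\<forall>r. a = r * b \<longrightarrow> r \<in> ring_units))"

text \<open>
  Very strong associateness need not be reflexive, which is why ``equal or \<open>\<beta>\<close>'' appears below
  rather than \<open>\<beta>\<close> alone.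
\<close>

definition eq_or :: "('a \<Rightarrow> 'a \<Rightarrow> bool) \<Rightarrow> 'a \<Rightarrow> 'a \<Rightarrow> bool" where
  "eq_or \<beta> a b \<longleftrightarrow> a = b \<or> \<beta> a b"

definition nonunit_representatives ::
    "('a::comm_ring_1 \<Rightarrow> 'a \<Rightarrow> bool) \<Rightarrow> 'a set \<Rightarrow> bool" where
  "nonunit_representatives \<beta> A \<longleftrightarrow>
     (\<forall>a\<in>A. a \<notin> ring_units) \<and> (\<forall>a. a \<notin> ring_units \<longrightarrow> (\<exists>!r. r \<in> A \<and> eq_or \<beta> a r))"

definition factorizations :: "'a::comm_ring_1 \<Rightarrow> 'a list set" where
  "factorizations x = {as. as \<noteq> [] \<and> (\<forall>a\<in>set as. a \<notin> ring_units) \<and> prod_list as = x}"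

text \<open>\<open>bs'\<close> ranges over the rearrangements of \<open>bs\<close>.\<close>

definition agree_upto :: "('a \<Rightarrow> 'a \<Rightarrow> bool) \<Rightarrow> 'a list \<Rightarrow> 'a list \<Rightarrow> bool" where
  "agree_upto \<beta> as bs \<longleftrightarrow> (\<exists>bs'. mset bs' = mset bs \<and> list_all2 (eq_or \<beta>) as bs')"

definition finitely_many_factorizations ::
    "('a::comm_ring_1 \<Rightarrow> 'a \<Rightarrow> bool) \<Rightarrow> 'a \<Rightarrow> bool" where
  "finitely_many_factorizations \<beta> x \<longleftrightarrow>
     finite (factorizations x //
       {(as, bs). as \<in> factorizations x \<and> bs \<in> factorizations x \<and> agree_upto \<beta> as bs})"

text \<open>
  The divisor graph of \<open>x\<close>, relative to a fixed set \<open>A\<close> of representatives of the non-units.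
  The relation \<open>\<beta>\<close> enters only through \<open>A\<close>.
\<close>

definition dg_verts :: "'a::comm_ring_1 set \<Rightarrow> 'a \<Rightarrow> 'a set" where
  "dg_verts A x = {a \<in> A. a dvd x}"

definition dg_adj :: "'a::comm_ring_1 set \<Rightarrow> 'a \<Rightarrow> 'a \<Rightarrow> 'a \<Rightarrow> bool" where
  "dg_adj A x a b \<longleftrightarrow> a \<in> dg_verts A x \<and> b \<in> dg_verts A x \<and> a \<noteq> b \<and>
     (\<exists>u cs. u \<in> ring_units \<and> (\<forall>c\<in>set cs. c \<notin> ring_units) \<and> x = u * a * b * prod_list cs)"

definition loop_exponents :: "'a::comm_ring_1 \<Rightarrow> 'a \<Rightarrow> nat set" where
  "loop_exponents x a = {n. n \<ge> 1 \<and>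
     (\<exists>u cs. u \<in> ring_units \<and> (\<forall>c\<in>set cs. c \<notin> ring_units) \<and> x = u * a ^ n * prod_list cs)}"

definition loops :: "'a::comm_ring_1 \<Rightarrow> 'a \<Rightarrow> enat" where
  "loops x a =
     (if loop_exponents x a = {} then 0
      else if bdd_above (loop_exponents x a) then enat (Max (loop_exponents x a) - 1)
      else \<infinity>)"

datatype 'a dg_edge = Edge "'a set" | Loop 'a nat

text \<open>The loops at \<open>a\<close> are numbered \<open>0, 1, \<dots>\<close>, so that \<open>loops x a\<close> of them are distinct edges.\<close>

definition dg_edges :: "'a::comm_ring_1 set \<Rightarrow> 'a \<Rightarrow> 'a dg_edge set" where
  "dg_edges A x = {Edge {a, b} | a b. dg_adj A x a b} \<union>
     {Loop a i | a i. a \<in> dg_verts A x \<and> enat i < loops x a}"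

definition ecard :: "'b set \<Rightarrow> enat" where
  "ecard S = (if finite S then enat (card S) else \<infinity>)"

definition dg_deg :: "'a::comm_ring_1 set \<Rightarrow> 'a \<Rightarrow> 'a \<Rightarrow> enat" where
  "dg_deg A x a = ecard {b \<in> dg_verts A x. b \<noteq> a \<and> dg_adj A x a b}"

text \<open>
  Sums of \<open>dg_degl\<close> over infinite vertex sets are meaningful in \<^typ>\<open>enat\<close>, where every family
  is summable (\<open>summable_on_enat\<close>).
\<close>

definition dg_degl :: "'a::comm_ring_1 set \<Rightarrow> 'a \<Rightarrow> 'a \<Rightarrow> enat" where
  "dg_degl A x a = dg_deg A x a + loops x a"

end

theory Submission
  imports Defs
begin

text \<open>
  Up to a unit, every element is either \<open>1\<close> or a single non-unit factor. A product of
  non-units together with a unit is therefore an arbitrary element, and the divisor graph is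
  described by divisibility alone: distinct vertices \<open>a\<close>, \<open>b\<close> are adjacent iff \<open>a * b dvd x\<close>,
  and the loops at \<open>a\<close> count the powers of \<open>a\<close> dividing \<open>x\<close>.

  All three conditions of the theorem are equivalent to a fourth one, \<open>bounded_divisors\<close>: only
  finitely many vertices exist, and each has bounded powers dividing \<open>x\<close>.

  For the factorizations, replace every factor by its representative in \<open>A\<close>. Two factorizations
  agree up to order and \<open>\<beta>\<close> iff the resulting multisets coincide, so the first condition says that
  finitely many multisets occur (\<open>finitely_many_factorizations_iff\<close>). If the divisors are bounded,
  these multisets have a finite support and bounded multiplicities, since a representative divides
  the factor that it replaces. Conversely, if finitely many multisets occur then their sizes are
  bounded, which bounds the exponents \<open>n\<close> with \<open>a ^ n dvd x\<close>. Moreover, only finitely many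
  representatives occur in these multisets, and every vertex other than the representative of \<open>x\<close>
  is one of them, being a factor in a factorization into two non-units.

  For the graph, the only difficulty is that vertices without edges are seen neither by the degree
  sum nor by the edge set. There is at most one of them: a vertex whose cofactors in \<open>x\<close> are all
  units can only be the representative of \<open>x\<close> (\<open>vertex_eq_rep_or_nonunit_cofactor\<close>), and any
  other vertex has a non-unit cofactor, whose representative provides an edge or a loop.

  The relation \<open>\<beta>\<close> enters through three properties shared by the three kinds of associates, which
  are collected in the locale \<open>associates\<close>.
\<close>

section \<open>The three kinds of associates\<close>

text \<open>
  The last assumption is the one in which very strong associates differ from the other two
  relations: when \<open>a = s * a\<close> for a non-unit \<open>s\<close>, the unit multiples of \<open>a\<close> need not be
  identified with \<open>a\<close>.
\<close>

locale associates =
  fixes \<beta> :: "'a::comm_ring_1 \<Rightarrow> 'a \<Rightarrow> bool"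
  assumes equivp_eq_or: "equivp (eq_or \<beta>)"
    and dvd_if_eq_or: "eq_or \<beta> a b \<Longrightarrow> a dvd b"
    and eq_or_unit_mult: "u \<in> ring_units \<Longrightarrow> (\<And>s. a = s * a \<Longrightarrow> s \<in> ring_units) \<Longrightarrow> eq_or \<beta> (u * a) a"

lemma assoc_rel_iff_dvd: "assoc_rel a b \<longleftrightarrow> a dvd b \<and> b dvd a"
proof
  assume "assoc_rel a b"
  then have eq: "principal_ideal a = principal_ideal b"
    by (simp add: assoc_rel_def)
  have self: "c \<in> principal_ideal c" for c :: 'a
    by (force simp: principal_ideal_def intro: exI[of _ 1])
  show "a dvd b \<and> b dvd a"
    using self[of a] self[of b] eq unfolding principal_ideal_def by (auto simp: dvd_def ac_simps)
next
  assume "a dvd b \<and> b dvd a"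
  moreover have "principal_ideal c = {y. c dvd y}" for c :: 'a
    by (auto simp: principal_ideal_def dvd_def ac_simps)
  ultimately show "assoc_rel a b"
    unfolding assoc_rel_def by (auto intro: dvd_trans)
qed

lemma ring_units_mult_iff: "a * b \<in> ring_units \<longleftrightarrow> a \<in> ring_units \<and> b \<in> ring_units"
  unfolding ring_units_def by (auto dest: dvd_mult_left dvd_mult_right intro: mult_dvd_mono[of _ 1 _ 1, simplified])

lemma ring_unit_inverse:
  assumes "u \<in> ring_units"
  obtains v where "v \<in> ring_units" "u * v = 1"
  using assms unfolding ring_units_def by (metis dvdE dvd_triv_right mem_Collect_eq)

lemma one_in_ring_units: "1 \<in> ring_units"
  by (simp add: ring_units_def)

lemma equivp_strong_assoc_rel: "equivp (strong_assoc_rel :: 'a::comm_ring_1 \<Rightarrow> 'a \<Rightarrow> bool)"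
proof (rule equivpI)
  show "reflp (strong_assoc_rel :: 'a \<Rightarrow> 'a \<Rightarrow> bool)"
    by (auto intro!: reflpI exI[of _ 1] simp: strong_assoc_rel_def one_in_ring_units)
  show "symp (strong_assoc_rel :: 'a \<Rightarrow> 'a \<Rightarrow> bool)"
  proof (rule sympI)
    fix a b :: 'a
    assume "strong_assoc_rel a b"
    then obtain u where u: "u \<in> ring_units" "a = u * b"
      by (auto simp: strong_assoc_rel_def)
    obtain v where v: "v \<in> ring_units" "u * v = 1"
      using ring_unit_inverse[OF u(1)] .
    have "b = v * a"
      by (metis u(2) v(2) mult.assoc mult.commute mult_1)
    then show "strong_assoc_rel b a"
      using v(1) by (auto simp: strong_assoc_rel_def)
  qed
  show "transp (strong_assoc_rel :: 'a \<Rightarrow> 'a \<Rightarrow> bool)"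
    unfolding strong_assoc_rel_def by (rule transpI) (metis mult.assoc ring_units_mult_iff)
qed

lemma strong_assoc_rel_imp_dvd: "strong_assoc_rel a b \<Longrightarrow> a dvd b"
  by (metis equivp_strong_assoc_rel equivp_symp strong_assoc_rel_def dvd_triv_right)

lemma very_strong_imp_strong_assoc_rel:
  assumes "very_strong_assoc_rel a b"
  shows "strong_assoc_rel a b"
proof -
  have "b dvd a"
    using assms by (simp add: very_strong_assoc_rel_def assoc_rel_iff_dvd)
  then obtain r where "a = r * b"
    by (auto simp: dvd_def ac_simps)
  then show ?thesis
    using assms one_in_ring_units unfolding very_strong_assoc_rel_def strong_assoc_rel_def
    by (metis mult_1)
qed

text \<open>
  Very strong associates are exactly the strong associates of an element that is either \<open>0\<close> or not
  reproduced by a non-unit multiple. That property is invariant under multiplication by units, so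
  symmetry and transitivity are inherited from strong associates.
\<close>

lemma very_strong_assoc_rel_iff:
  "very_strong_assoc_rel a b \<longleftrightarrow>
     strong_assoc_rel a b \<and> (b = 0 \<or> (\<forall>s. b = s * b \<longrightarrow> s \<in> ring_units))"
proof
  assume *: "very_strong_assoc_rel a b"
  then have strong: "strong_assoc_rel a b"
    by (rule very_strong_imp_strong_assoc_rel)
  then obtain u where u: "u \<in> ring_units" "a = u * b"
    by (auto simp: strong_assoc_rel_def)
  have "s \<in> ring_units" if "b \<noteq> 0" "b = s * b" for s
  proof -
    have "a = (u * s) * b"
      using u(2) that(2) by (simp add: mult.assoc)
    then have "u * s \<in> ring_units"
      using * that(1) by (auto simp: very_strong_assoc_rel_def)
    then show ?thesis
      by (simp add: ring_units_mult_iff)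
  qed
  with strong show "strong_assoc_rel a b \<and> (b = 0 \<or> (\<forall>s. b = s * b \<longrightarrow> s \<in> ring_units))"
    by blast
next
  assume *: "strong_assoc_rel a b \<and> (b = 0 \<or> (\<forall>s. b = s * b \<longrightarrow> s \<in> ring_units))"
  then obtain u where u: "u \<in> ring_units" "a = u * b"
    by (auto simp: strong_assoc_rel_def)
  obtain v where v: "v \<in> ring_units" "u * v = 1"
    using ring_unit_inverse[OF u(1)] .
  have b: "b = v * a"
    by (metis u(2) v(2) mult.assoc mult.commute mult_1)
  have "r \<in> ring_units" if "b \<noteq> 0" "a = r * b" for r
  proof -
    have "b = (v * r) * b"
      using b that(2) by (simp add: mult.assoc)
    then have "v * r \<in> ring_units"
      using * that(1) by blast
    then show ?thesis
      by (simp add: ring_units_mult_iff)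
  qed
  moreover have "assoc_rel a b"
    unfolding assoc_rel_iff_dvd using b u(2) by (metis dvd_triv_right)
  ultimately show "very_strong_assoc_rel a b"
    using u(2) unfolding very_strong_assoc_rel_def by (cases "b = 0") simp_all
qed

lemma equivp_eq_or_of_symp_transp:
  assumes "symp \<beta>" "transp \<beta>"
  shows "equivp (eq_or \<beta>)"
  using assms
  by (intro equivpI reflpI sympI transpI) (auto simp: eq_or_def dest: sympD transpD)

lemma associates_assoc_rel: "associates assoc_rel"
proof
  show "equivp (eq_or (assoc_rel :: 'a \<Rightarrow> 'a \<Rightarrow> bool))"
    by (rule equivp_eq_or_of_symp_transp)
       (auto intro!: sympI transpI simp: assoc_rel_def)
  show "a dvd b" if "eq_or assoc_rel a b" for a b :: 'a
    using that by (auto simp: eq_or_def assoc_rel_iff_dvd)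
  show "eq_or assoc_rel (u * a) a" if "u \<in> ring_units" for u a :: 'a
    using that strong_assoc_rel_imp_dvd[of "u * a" a]
    by (auto simp: eq_or_def assoc_rel_iff_dvd strong_assoc_rel_def)
qed

lemma associates_strong_assoc_rel: "associates strong_assoc_rel"
proof
  show "equivp (eq_or (strong_assoc_rel :: 'a \<Rightarrow> 'a \<Rightarrow> bool))"
    using equivp_strong_assoc_rel
    by (intro equivp_eq_or_of_symp_transp) (auto simp: equivp_reflp_symp_transp)
  show "a dvd b" if "eq_or strong_assoc_rel a b" for a b :: 'a
    using that strong_assoc_rel_imp_dvd by (auto simp: eq_or_def)
  show "eq_or strong_assoc_rel (u * a) a" if "u \<in> ring_units" for u a :: 'a
    using that by (auto simp: eq_or_def strong_assoc_rel_def)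
qed

lemma associates_very_strong_assoc_rel: "associates very_strong_assoc_rel"
proof
  have sym: "strong_assoc_rel b a" if "strong_assoc_rel a b" for a b :: 'a
    using that equivp_strong_assoc_rel by (rule equivp_symp[rotated])
  have rigid: "a = 0 \<or> (\<forall>s. a = s * a \<longrightarrow> s \<in> ring_units)"
    if strong: "strong_assoc_rel a b" and b: "b = 0 \<or> (\<forall>s. b = s * b \<longrightarrow> s \<in> ring_units)" for a b :: 'a
  proof -
    obtain u where u: "a = u * b"
      using strong by (auto simp: strong_assoc_rel_def)
    obtain v where v: "b = v * a"
      using sym[OF strong] by (auto simp: strong_assoc_rel_def)
    have "s \<in> ring_units" if "b \<noteq> 0" "a = s * a" for s
    proof -
      have "b = s * b"
        using v that(2) by (metis mult.left_commute)
      then show ?thesis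
        using b that(1) by blast
    qed
    then show ?thesis
      using u by (cases "b = 0") (simp, blast)
  qed
  show "equivp (eq_or (very_strong_assoc_rel :: 'a \<Rightarrow> 'a \<Rightarrow> bool))"
  proof (rule equivp_eq_or_of_symp_transp)
    show "symp (very_strong_assoc_rel :: 'a \<Rightarrow> 'a \<Rightarrow> bool)"
      by (rule sympI) (use sym rigid in \<open>unfold very_strong_assoc_rel_iff, blast\<close>)
    show "transp (very_strong_assoc_rel :: 'a \<Rightarrow> 'a \<Rightarrow> bool)"
      by (rule transpI)
         (use equivp_transp[OF equivp_strong_assoc_rel] in \<open>unfold very_strong_assoc_rel_iff, blast\<close>)
  qed
  show "a dvd b" if "eq_or very_strong_assoc_rel a b" for a b :: 'a
    using that strong_assoc_rel_imp_dvd by (auto simp: eq_or_def very_strong_assoc_rel_iff)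
  show "eq_or very_strong_assoc_rel (u * a) a"
    if "u \<in> ring_units" "\<And>s. a = s * a \<Longrightarrow> s \<in> ring_units" for u a :: 'a
    using that by (auto simp: eq_or_def very_strong_assoc_rel_iff strong_assoc_rel_def)
qed

section \<open>The divisor graph in terms of divisibility\<close>

text \<open>
  The cofactor of \<open>d\<close> in \<open>x\<close> can itself serve as the unit, if it is one, and otherwise as the only
  factor in the list.
\<close>

lemma dvd_iff_unit_times_nonunits:
  "d dvd x \<longleftrightarrow> (\<exists>u cs. u \<in> ring_units \<and> (\<forall>c\<in>set cs. c \<notin> ring_units) \<and> x = u * d * prod_list cs)"
  (is "_ \<longleftrightarrow> ?R")
proof
  assume "d dvd x"
  then obtain t where t: "x = d * t" ..
  show ?R
  proof (cases "t \<in> ring_units")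
    case True
    then show ?thesis
      using t by (intro exI[of _ t] exI[of _ "[]"]) (simp add: mult.commute)
  next
    case False
    then show ?thesis
      using t one_in_ring_units by (intro exI[of _ 1] exI[of _ "[t]"]) simp
  qed
next
  assume ?R
  then show "d dvd x"
    by auto
qed

lemma dg_adj_iff_dvd:
  "dg_adj A x a b \<longleftrightarrow> a \<in> dg_verts A x \<and> b \<in> dg_verts A x \<and> a \<noteq> b \<and> a * b dvd x"
  unfolding dg_adj_def dvd_iff_unit_times_nonunits[of "a * b"] by (simp add: mult.assoc)

lemma loop_exponents_eq: "loop_exponents x a = {n. n \<ge> 1 \<and> a ^ n dvd x}"
  unfolding loop_exponents_def dvd_iff_unit_times_nonunits by simp

lemma loops_less_infinity_iff: "loops x a < \<infinity> \<longleftrightarrow> bdd_above {n. a ^ n dvd x}"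
proof -
  have "{n. a ^ n dvd x} = insert 0 (loop_exponents x a)"
    by (auto simp: loop_exponents_eq)
  then have "bdd_above {n. a ^ n dvd x} \<longleftrightarrow> bdd_above (loop_exponents x a)"
    by simp
  then show ?thesis
    by (simp add: loops_def zero_enat_def)
qed

lemma loops_pos_if_square_dvd:
  assumes "a ^ 2 dvd x"
  shows "0 < loops x a"
proof (cases "bdd_above (loop_exponents x a)")
  case True
  have "2 \<in> loop_exponents x a"
    using assms by (simp add: loop_exponents_eq)
  moreover from this have "2 \<le> Max (loop_exponents x a)"
    using True by (intro Max_ge) (auto simp: bdd_above_nat)
  ultimately show ?thesis
    using True by (auto simp: loops_def zero_enat_def)
next
  case False
  moreover from this have "loop_exponents x a \<noteq> {}"
    by auto
  ultimately show ?thesis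
    by (simp add: loops_def)
qed

section \<open>Finite sums of extended naturals\<close>

lemma infsum_enat_less_infinity_iff:
  fixes f :: "'b \<Rightarrow> enat"
  shows "infsum f S < \<infinity> \<longleftrightarrow> finite {a \<in> S. f a \<noteq> 0} \<and> (\<forall>a\<in>S. f a < \<infinity>)"
proof -
  let ?T = "{a \<in> S. f a \<noteq> 0}"
  have supp: "infsum f S = infsum f ?T"
    by (rule infsum_cong_neutral) auto
  show ?thesis
  proof (cases "finite ?T")
    case True
    have "sum f B < \<infinity> \<longleftrightarrow> (\<forall>a\<in>B. f a < \<infinity>)" if "finite B" for B
      using that
      by induction (simp_all add: plus_eq_infty_iff_enat del: not_infinity_eq)
    then have "infsum f S < \<infinity> \<longleftrightarrow> (\<forall>a\<in>?T. f a < \<infinity>)"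
      using True supp by simp
    also have "\<dots> \<longleftrightarrow> (\<forall>a\<in>S. f a < \<infinity>)"
    proof -
      have "f a < \<infinity>" if "f a = 0" for a
        using that by simp
      then show ?thesis
        by blast
    qed
    finally show ?thesis
      using True by blast
  next
    case False
    have "infsum f ?T = \<infinity>"
    proof (rule infsum_superconst_infinite_enat[OF _ _ False])
      show "1 \<le> f a" if "a \<in> ?T" for a
        using that by (simp add: one_eSuc ileI1)
    qed simp
    with supp have "infsum f S = \<infinity>"
      by (rule trans)
    with False show ?thesis
      by (metis less_irrefl)
  qed
qed

section \<open>Representatives of factors\<close>

locale divisor_graph = associates \<beta>
  for \<beta> :: "'a::comm_ring_1 \<Rightarrow> 'a \<Rightarrow> bool" +
  fixes A :: "'a set" and x :: 'a
  assumes representatives: "nonunit_representatives \<beta> A"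
    and nonunit: "x \<notin> ring_units"
begin

definition rep :: "'a \<Rightarrow> 'a" where
  "rep a = (THE r. r \<in> A \<and> eq_or \<beta> a r)"

definition rep_mset :: "'a list \<Rightarrow> 'a multiset" where
  "rep_mset as = image_mset rep (mset as)"

definition bounded_divisors :: bool where
  "bounded_divisors \<longleftrightarrow>
     finite (dg_verts A x) \<and> (\<forall>a\<in>dg_verts A x. bdd_above {n. a ^ n dvd x})"

lemma vertex_nonunit: "a \<in> A \<Longrightarrow> a \<notin> ring_units"
  using representatives by (auto simp: nonunit_representatives_def)

lemma rep_in: "a \<notin> ring_units \<Longrightarrow> rep a \<in> A"
  and eq_or_rep: "a \<notin> ring_units \<Longrightarrow> eq_or \<beta> a (rep a)"
proof -
  assume "a \<notin> ring_units"
  then have "\<exists>!r. r \<in> A \<and> eq_or \<beta> a r"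
    using representatives by (simp add: nonunit_representatives_def)
  then have "rep a \<in> A \<and> eq_or \<beta> a (rep a)"
    unfolding rep_def by (rule theI')
  then show "rep a \<in> A" "eq_or \<beta> a (rep a)"
    by auto
qed

lemma rep_unique: "r \<in> A \<Longrightarrow> eq_or \<beta> a r \<Longrightarrow> a \<notin> ring_units \<Longrightarrow> rep a = r"
  using representatives rep_in eq_or_rep unfolding nonunit_representatives_def by blast

lemma rep_vertex: "a \<in> A \<Longrightarrow> rep a = a"
  by (rule rep_unique) (auto simp: eq_or_def vertex_nonunit)

lemma rep_dvd: "a \<notin> ring_units \<Longrightarrow> rep a dvd a"
  by (rule dvd_if_eq_or) (rule equivp_symp[OF equivp_eq_or eq_or_rep])

lemma eq_or_iff_rep_eq:
  assumes "a \<notin> ring_units" "b \<notin> ring_units"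
  shows "eq_or \<beta> a b \<longleftrightarrow> rep a = rep b"
proof
  assume "eq_or \<beta> a b"
  then have "eq_or \<beta> a (rep b)"
    using eq_or_rep[OF assms(2)] by (rule equivp_transp[OF equivp_eq_or])
  then show "rep a = rep b"
    using assms rep_in by (intro rep_unique)
next
  assume "rep a = rep b"
  then have "eq_or \<beta> (rep a) b"
    using eq_or_rep[OF assms(2)] by (simp add: equivp_symp[OF equivp_eq_or])
  with eq_or_rep[OF assms(1)] show "eq_or \<beta> a b"
    by (rule equivp_transp[OF equivp_eq_or])
qed

lemma agree_upto_iff_rep_mset_eq:
  assumes "\<forall>a\<in>set as. a \<notin> ring_units" "\<forall>b\<in>set bs. b \<notin> ring_units"
  shows "agree_upto \<beta> as bs \<longleftrightarrow> rep_mset as = rep_mset bs"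
proof -
  have eq_or_iff: "list_all2 (eq_or \<beta>) as bs' \<longleftrightarrow> map rep as = map rep bs'"
    if "mset bs' = mset bs" for bs'
  proof -
    have "\<forall>b\<in>set bs'. b \<notin> ring_units"
      using assms(2) mset_eq_setD[OF that] by simp
    then have "list_all2 (eq_or \<beta>) as bs' \<longleftrightarrow> list_all2 (\<lambda>a b. rep a = rep b) as bs'"
      using assms(1) eq_or_iff_rep_eq by (intro list.rel_cong) auto
    also have "\<dots> \<longleftrightarrow> map rep as = map rep bs'"
      by (simp add: list.rel_map flip: list.rel_eq)
    finally show ?thesis .
  qed
  have "agree_upto \<beta> as bs \<longleftrightarrow> (\<exists>bs'. mset bs' = mset bs \<and> map rep as = map rep bs')"
    unfolding agree_upto_def using eq_or_iff by blast
  also have "\<dots> \<longleftrightarrow> rep_mset as = rep_mset bs"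
  proof
    assume "\<exists>bs'. mset bs' = mset bs \<and> map rep as = map rep bs'"
    then show "rep_mset as = rep_mset bs"
      unfolding rep_mset_def by (metis mset_map)
  next
    assume "rep_mset as = rep_mset bs"
    then have "mset (map rep as) = mset (map rep bs)"
      by (simp add: rep_mset_def)
    moreover have "list_all2 (\<lambda>r b. r = rep b) (map rep bs) bs"
      by (simp add: list_all2_map1 list_all2_same)
    ultimately obtain bs' where "list_all2 (\<lambda>r b. r = rep b) (map rep as) bs'" "mset bs' = mset bs"
      using list_all2_reorder_left_invariance by blast
    moreover from this have "map rep as = map rep bs'"
      by (simp add: list_all2_map2 flip: list.rel_eq)
    ultimately show "\<exists>bs'. mset bs' = mset bs \<and> map rep as = map rep bs'"
      by blast
  qed
  finally show ?thesis .
qed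

text \<open>
  The classes of factorizations are the fibres of \<^const>\<open>rep_mset\<close>, so they can be counted by
  the values of this map.
\<close>

lemma finitely_many_factorizations_iff:
  "finitely_many_factorizations \<beta> x \<longleftrightarrow> finite (rep_mset ` factorizations x)"
proof -
  let ?F = "factorizations x"
  let ?fibre = "\<lambda>N. {bs \<in> ?F. rep_mset bs = N}"
  have "{(as, bs). as \<in> ?F \<and> bs \<in> ?F \<and> agree_upto \<beta> as bs}
      = {(as, bs). as \<in> ?F \<and> bs \<in> ?F \<and> rep_mset bs = rep_mset as}"
    using agree_upto_iff_rep_mset_eq by (auto simp: factorizations_def)
  then have "?F // {(as, bs). as \<in> ?F \<and> bs \<in> ?F \<and> agree_upto \<beta> as bs} = ?fibre ` rep_mset ` ?F"
    by (auto simp: quotient_def image_image Image_def)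
  moreover have "inj_on ?fibre (rep_mset ` ?F)"
    by (rule inj_onI) blast
  ultimately show ?thesis
    by (simp add: finitely_many_factorizations_def finite_image_iff)
qed

lemma rep_mset_dvd:
  assumes "\<forall>a\<in>set as. a \<notin> ring_units"
  shows "prod_mset (rep_mset as) dvd prod_list as"
  using assms by (induction as) (auto simp: rep_mset_def intro!: mult_dvd_mono rep_dvd)

text \<open>
  If \<open>x = a * r\<close> with \<open>r\<close> a unit and \<open>x = s * x\<close> for some non-unit \<open>s\<close>, then \<open>r * s\<close> is a
  non-unit cofactor of \<open>a\<close>. If there is no such \<open>s\<close>, the unit multiple \<open>a\<close> of \<open>x\<close> is identified
  with \<open>x\<close> for each of the three relations.
\<close>

lemma vertex_eq_rep_or_nonunit_cofactor:
  assumes "a \<in> dg_verts A x" "a \<noteq> rep x"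
  obtains r where "r \<notin> ring_units" "x = a * r"
proof -
  from assms(1) obtain r where a: "a \<in> A" and r: "x = a * r"
    by (auto simp: dg_verts_def)
  show thesis
  proof (cases "r \<in> ring_units")
    case True
    obtain v where v: "v \<in> ring_units" "r * v = 1"
      using ring_unit_inverse[OF True] .
    have "\<exists>s. x = s * x \<and> s \<notin> ring_units"
    proof (rule ccontr)
      assume "\<not> ?thesis"
      then have "eq_or \<beta> (v * x) x"
        using v(1) by (intro eq_or_unit_mult) auto
      moreover have "v * x = a"
        using r v(2) by (metis mult.assoc mult.commute mult_1)
      ultimately have "rep x = a"
        using a nonunit by (intro rep_unique) (auto intro: equivp_symp[OF equivp_eq_or])
      with assms(2) show False
        by simp
    qed
    then obtain s where s: "x = s * x" "s \<notin> ring_units"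
      by blast
    have "x = a * (r * s)"
      using r s(1) by (metis mult.assoc mult.commute)
    then show thesis
      using s(2) that ring_units_mult_iff by blast
  qed (use r that in blast)
qed

section \<open>Factorizations and bounded divisors\<close>

lemma bounded_divisors_imp_finite_rep_msets:
  assumes "bounded_divisors"
  shows "finite (rep_mset ` factorizations x)"
proof -
  let ?V = "dg_verts A x"
  have fin: "finite ?V"
    using assms by (simp add: bounded_divisors_def)
  have "\<forall>a\<in>?V. \<exists>k. \<forall>n. a ^ n dvd x \<longrightarrow> n \<le> k"
    using assms by (auto simp: bounded_divisors_def bdd_above_def)
  then obtain k where k: "\<And>a n. a \<in> ?V \<Longrightarrow> a ^ n dvd x \<Longrightarrow> n \<le> k a"
    by metis
  let ?L = "{as. set as \<subseteq> ?V \<and> length as \<le> sum k ?V}"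
  have "rep_mset as \<in> mset ` ?L" if as: "as \<in> factorizations x" for as
  proof -
    have nonunits: "\<forall>a\<in>set as. a \<notin> ring_units" and prod: "prod_list as = x"
      using as by (auto simp: factorizations_def)
    have dvd: "prod_mset (rep_mset as) dvd x"
      using rep_mset_dvd[OF nonunits] prod by simp
    have count_dvd: "a ^ count (rep_mset as) a dvd x" for a
    proof -
      have "replicate_mset (count (rep_mset as) a) a \<subseteq># rep_mset as"
        by (simp flip: count_le_replicate_mset_subset_eq)
      then show ?thesis
        using prod_mset_subset_imp_dvd dvd by (metis dvd_trans prod_mset_replicate_mset)
    qed
    have supp: "set_mset (rep_mset as) \<subseteq> ?V"
    proof
      fix a assume a: "a \<in># rep_mset as"
      then have "a \<in> A"
        using nonunits rep_in by (auto simp: rep_mset_def)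
      moreover have "a dvd x"
        using dvd_prod_mset[OF a] dvd by (rule dvd_trans)
      ultimately show "a \<in> ?V"
        by (simp add: dg_verts_def)
    qed
    have "size (rep_mset as) = (\<Sum>a\<in>set_mset (rep_mset as). count (rep_mset as) a)"
      by (simp add: size_multiset_overloaded_eq)
    also have "\<dots> \<le> (\<Sum>a\<in>?V. count (rep_mset as) a)"
      using fin supp by (intro sum_mono2) auto
    also have "\<dots> \<le> sum k ?V"
      using k count_dvd by (intro sum_mono) auto
    finally have "size (rep_mset as) \<le> sum k ?V" .
    moreover obtain bs where "mset bs = rep_mset as"
      using ex_mset by blast
    ultimately show ?thesis
      using supp by (intro image_eqI[of _ _ bs]) (auto simp flip: set_mset_mset size_mset)
  qed
  then have "rep_mset ` factorizations x \<subseteq> mset ` ?L"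
    by blast
  then show ?thesis
    using finite_lists_length_le[OF fin] by (rule finite_surj[rotated])
qed

lemma finite_rep_msets_imp_bounded_divisors:
  assumes fin: "finite (rep_mset ` factorizations x)"
  shows "bounded_divisors"
  unfolding bounded_divisors_def
proof (intro conjI ballI)
  have "dg_verts A x \<subseteq> insert (rep x) (\<Union>N\<in>rep_mset ` factorizations x. set_mset N)"
  proof
    fix a assume a: "a \<in> dg_verts A x"
    show "a \<in> insert (rep x) (\<Union>N\<in>rep_mset ` factorizations x. set_mset N)"
    proof (cases "a = rep x")
      case False
      then obtain r where "r \<notin> ring_units" "x = a * r"
        using vertex_eq_rep_or_nonunit_cofactor[OF a] by blast
      then have "[a, r] \<in> factorizations x"
        using a vertex_nonunit by (auto simp: factorizations_def dg_verts_def)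
      moreover have "a \<in># rep_mset [a, r]"
        using a by (simp add: rep_mset_def dg_verts_def rep_vertex)
      ultimately show ?thesis
        by blast
    qed simp
  qed
  then show "finite (dg_verts A x)"
    by (rule finite_subset) (intro finite.insertI finite_UN_I fin, simp)
next
  fix a assume "a \<in> dg_verts A x"
  then have a: "a \<notin> ring_units"
    using vertex_nonunit by (simp add: dg_verts_def)
  have "n \<le> Max (size ` rep_mset ` factorizations x)" if "a ^ n dvd x" for n
  proof (cases n)
    case (Suc m)
    obtain c where c: "x = a ^ n * c"
      using \<open>a ^ n dvd x\<close> ..
    \<comment> \<open>The cofactor may be a unit, so it is merged with one of the factors \<open>a\<close>.\<close>
    let ?as = "(c * a) # replicate m a"
    have "?as \<in> factorizations x"
      using a c Suc by (auto simp: factorizations_def ring_units_mult_iff prod_list_replicate ac_simps)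
    moreover have "size (rep_mset ?as) = n"
      using Suc by (simp add: rep_mset_def)
    ultimately show ?thesis
      using fin by (intro Max_ge) force+
  qed simp
  then show "bdd_above {n. a ^ n dvd x}"
    by (auto simp: bdd_above_def)
qed

section \<open>The graph and bounded divisors\<close>

text \<open>
  The representative of a non-unit cofactor of \<open>a\<close> is a neighbour of \<open>a\<close>, or equal to \<open>a\<close>; in the
  latter case \<open>a ^ 2 dvd x\<close>, which gives a loop.
\<close>

lemma vertex_adjacent_or_looped:
  assumes a: "a \<in> dg_verts A x" and "a \<noteq> rep x"
  shows "(\<exists>b. dg_adj A x a b) \<or> 0 < loops x a"
proof -
  obtain r where r: "r \<notin> ring_units" "x = a * r"
    using vertex_eq_rep_or_nonunit_cofactor assms by blast
  have dvd: "a * rep r dvd x"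
    using r rep_dvd by (auto intro: mult_dvd_mono)
  then have "rep r \<in> dg_verts A x"
    using r(1) rep_in by (auto simp: dg_verts_def dest: dvd_mult_right)
  then show ?thesis
    using a dvd loops_pos_if_square_dvd[of a]
    by (cases "rep r = a") (auto simp: dg_adj_iff_dvd power2_eq_square)
qed

lemma dg_degl_nonzero:
  assumes "a \<in> dg_verts A x" "a \<noteq> rep x"
  shows "dg_degl A x a \<noteq> 0"
proof
  assume "dg_degl A x a = 0"
  then have deg: "dg_deg A x a = 0" and "loops x a = 0"
    by (auto simp: dg_degl_def)
  then obtain b where b: "dg_adj A x a b"
    using vertex_adjacent_or_looped[OF assms] by auto
  then have "b \<in> {b \<in> dg_verts A x. b \<noteq> a \<and> dg_adj A x a b}"
    by (auto simp: dg_adj_def)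
  with deg show False
    by (auto simp: dg_deg_def ecard_def zero_enat_def split: if_splits)
qed

lemma degree_sum_finite_iff:
  "(\<Sum>\<^sub>\<infinity>a\<in>dg_verts A x. dg_degl A x a) < \<infinity> \<longleftrightarrow> bounded_divisors"
  unfolding infsum_enat_less_infinity_iff
proof
  assume *: "finite {a \<in> dg_verts A x. dg_degl A x a \<noteq> 0} \<and> (\<forall>a\<in>dg_verts A x. dg_degl A x a < \<infinity>)"
  have "dg_verts A x \<subseteq> insert (rep x) {a \<in> dg_verts A x. dg_degl A x a \<noteq> 0}"
    using dg_degl_nonzero by blast
  then have "finite (dg_verts A x)"
    using * by (auto intro: finite_subset)
  moreover have "loops x a < \<infinity>" if "a \<in> dg_verts A x" for a
  proof -
    have "loops x a \<le> dg_degl A x a"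
      by (simp add: dg_degl_def)
    with * that show ?thesis
      by (blast intro: le_less_trans)
  qed
  ultimately show "bounded_divisors"
    unfolding bounded_divisors_def loops_less_infinity_iff[symmetric] by auto
next
  assume bounded: "bounded_divisors"
  have fin: "finite (dg_verts A x)"
    using bounded unfolding bounded_divisors_def by blast
  moreover have "\<forall>a\<in>dg_verts A x. loops x a < \<infinity>"
    using bounded unfolding bounded_divisors_def loops_less_infinity_iff by (elim conjE)
  moreover have "dg_deg A x a < \<infinity>" for a
    using fin by (simp add: dg_deg_def ecard_def)
  ultimately have "dg_degl A x a < \<infinity>" if "a \<in> dg_verts A x" for a
    using that by (simp add: dg_degl_def plus_eq_infty_iff_enat del: not_infinity_eq)
  with fin show "finite {a \<in> dg_verts A x. dg_degl A x a \<noteq> 0} \<and> (\<forall>a\<in>dg_verts A x. dg_degl A x a < \<infinity>)"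
    by (metis finite_Collect_conjI Collect_mem_eq)
qed

lemma finite_edges_iff: "finite (dg_edges A x) \<longleftrightarrow> bounded_divisors"
proof
  assume fin: "finite (dg_edges A x)"
  let ?ends = "\<lambda>e. case e of Edge S \<Rightarrow> S | Loop a i \<Rightarrow> {a}"
  have "dg_verts A x \<subseteq> insert (rep x) (\<Union>e\<in>dg_edges A x. ?ends e)"
  proof
    fix a assume a: "a \<in> dg_verts A x"
    show "a \<in> insert (rep x) (\<Union>e\<in>dg_edges A x. ?ends e)"
    proof (cases "a = rep x")
      case False
      then consider b where "dg_adj A x a b" | "0 < loops x a"
        using vertex_adjacent_or_looped[OF a] by blast
      then show ?thesis
      proof cases
        case 1
        then have "Edge {a, b} \<in> dg_edges A x"
          by (auto simp: dg_edges_def)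
        then show ?thesis
          by force
      next
        case 2
        then have "Loop a 0 \<in> dg_edges A x"
          using a by (auto simp: dg_edges_def zero_enat_def)
        then show ?thesis
          by force
      qed
    qed simp
  qed
  moreover have "finite (?ends e)" if "e \<in> dg_edges A x" for e
    using that by (auto simp: dg_edges_def)
  ultimately have "finite (dg_verts A x)"
    using fin by (auto intro: finite_subset)
  moreover have "loops x a < \<infinity>" if a: "a \<in> dg_verts A x" for a
  proof (rule ccontr)
    assume "\<not> loops x a < \<infinity>"
    then have "range (Loop a) \<subseteq> dg_edges A x"
      using a by (auto simp: dg_edges_def)
    then have "finite (range (Loop a))"
      using fin by (rule finite_subset)
    then show False
      by (simp add: finite_image_iff inj_def)
  qed
  ultimately show "bounded_divisors"
    unfolding bounded_divisors_def loops_less_infinity_iff[symmetric] by auto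
next
  assume bounded: "bounded_divisors"
  have fin: "finite (dg_verts A x)"
    using bounded unfolding bounded_divisors_def by blast
  have loops: "\<forall>a\<in>dg_verts A x. loops x a < \<infinity>"
    using bounded unfolding bounded_divisors_def loops_less_infinity_iff by (elim conjE)
  have "{Edge {a, b} | a b. dg_adj A x a b} \<subseteq> (\<lambda>(a, b). Edge {a, b}) ` (dg_verts A x \<times> dg_verts A x)"
    by (auto simp: dg_adj_def)
  then have "finite {Edge {a, b} | a b. dg_adj A x a b}"
    by (rule finite_subset) (use fin in simp)
  moreover have "{Loop a i | a i. a \<in> dg_verts A x \<and> enat i < loops x a}
      = (\<Union>a\<in>dg_verts A x. Loop a ` {i. enat i < loops x a})"
    by auto
  moreover have "finite {i. enat i < loops x a}" if "a \<in> dg_verts A x" for a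
    using loops that by (cases "loops x a") auto
  ultimately show "finite (dg_edges A x)"
    using fin by (simp add: dg_edges_def)
qed

end

section \<open>The equivalence\<close>

theorem theorem5p5:
  fixes x :: "'a::comm_ring_1" and \<beta> :: "'a \<Rightarrow> 'a \<Rightarrow> bool" and A :: "'a set"
  assumes "\<beta> \<in> {assoc_rel, strong_assoc_rel, very_strong_assoc_rel}"
    and "nonunit_representatives \<beta> A"
    and "x \<notin> ring_units"
  shows "(finitely_many_factorizations \<beta> x \<longleftrightarrow> (\<Sum>\<^sub>\<infinity>a\<in>dg_verts A x. dg_degl A x a) < \<infinity>) \<and>
         ((\<Sum>\<^sub>\<infinity>a\<in>dg_verts A x. dg_degl A x a) < \<infinity> \<longleftrightarrow> finite (dg_edges A x))"
proof -
  have "associates \<beta>"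
    using assms(1) associates_assoc_rel associates_strong_assoc_rel associates_very_strong_assoc_rel
    by blast
  then interpret divisor_graph \<beta> A x
    using assms(2,3) by (intro divisor_graph.intro divisor_graph_axioms.intro)
  have "finitely_many_factorizations \<beta> x \<longleftrightarrow> bounded_divisors"
    unfolding finitely_many_factorizations_iff
    using bounded_divisors_imp_finite_rep_msets finite_rep_msets_imp_bounded_divisors by blast
  then show ?thesis
    unfolding degree_sum_finite_iff finite_edges_iff by blast
qed

end
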